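(* Let $\Omega\subset\mathbb{C}$ be a nonempty open set and let $\mathcal{X}\subset\operatorname{Hol}(\Omega)$ be a Hausdorff topological vector space satisfying properties P1, P2, P3 (see context). Then a family of polynomials $\mathcal{F}\subset\mathcal{P}_1$ is jointly cyclic in $\mathcal{X}$ if and only if $V(\mathcal{F})\cap\Omega_{max}=\emptyset$.
   Context: All vector spaces are over $\mathbb{C}$; topological vector spaces are not assumed locally convex. $\operatorname{Hol}(\Omega)$ is the space of holomorphic functions on $\Omega$. $\mathcal{P}_1$ is the set of polynomials in one complex variable, viewed (by restriction) as functions on $\Omega$. The properties are: P1: $\mathcal{P}_1\subset\mathcal{X}$ and $\mathcal{P}_1$ is dense in $\mathcal{X}$. P2: for each $w\in\Omega$ the evaluation functional $\Lambda_w(F)=F(w)$, $F\in\mathcal{X}$, is continuous. P3: the shift operator $SF(z)=zF(z)$ maps $\mathcal{X}$ to $\mathcal{X}$ and is continuous. For $F\in\mathcal{X}$, $S[F]:=\overline{\{PF:P\in\mathcal{P}_1\}}$ (closure in $\mathcal{X}$). For a family $\mathcal{F}\subset\mathcal{X}$, $S[\mathcal{F}]$ is the closed linear span in $\mathcal{X}$ of $\bigcup_{F\in\mathcal{F}}S[F]$; $\mathcal{F}$ is jointly cyclic if $S[\mathcal{F}]=\mathcal{X}$. $V(\mathcal{F}):=\{w\in\mathbb{C}:P(w)=0\text{ for all }P\in\mathcal{F}\}$. Maximal domain: $\Omega_{max}$ is the set of all $w\in\mathbb{C}$ such that the functional $P\mapsto P(w)$ on $\mathcal{P}_1$ extends to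 a continuous linear functional on $\mathcal{X}$. *)

theory Defs
  imports
    "HOL-Complex_Analysis.Complex_Analysis"
    "HOL-Computational_Algebra.Polynomial"
    "HOL-Library.Function_Algebras"
begin

definition cfun_scale :: "complex \<Rightarrow> (complex \<Rightarrow> complex) \<Rightarrow> complex \<Rightarrow> complex" where
  "cfun_scale c f = (\<lambda>z. c * f z)"

global_interpretation cfun: vector_space cfun_scale
  by unfold_locales (auto simp: cfun_scale_def fun_eq_iff algebra_simps)

text \<open>A function on \<open>\<Omega>\<close> is represented by its extension by zero to the whole plane, so that
  equality of representatives is equality on \<open>\<Omega>\<close> and the pointwise operations of the function
  type are those of the space of functions on \<open>\<Omega>\<close>.\<close>

definition Hol :: "complex set \<Rightarrow> (complex \<Rightarrow> complex) set" where
  "Hol \<Omega> = {f. f holomorphic_on \<Omega> \<and> (\<forall>z. z \<notin> \<Omega> \<longrightarrow> f z = 0)}"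

definition poly_on :: "complex set \<Rightarrow> complex poly \<Rightarrow> complex \<Rightarrow> complex" where
  "poly_on \<Omega> p = (\<lambda>z. if z \<in> \<Omega> then poly p z else 0)"

text \<open>The underlying vector space is the carrier of the topology, a linear subspace of the
  functions on the plane; the topology need not be locally convex.\<close>

definition topological_vector_space :: "(complex \<Rightarrow> complex) topology \<Rightarrow> bool" where
  "topological_vector_space X \<longleftrightarrow>
     cfun.subspace (topspace X) \<and>
     continuous_map (prod_topology X X) X (\<lambda>(f, g). f + g) \<and>
     continuous_map (prod_topology euclidean X) X (\<lambda>(c, f). cfun_scale c f)"

definition P1 :: "complex set \<Rightarrow> (complex \<Rightarrow> complex) topology \<Rightarrow> bool" where
  "P1 \<Omega> X \<longleftrightarrow> range (poly_on \<Omega>) \<subseteq> topspace X \<and> X closure_of range (poly_on \<Omega>) = topspace X"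

definition P2 :: "complex set \<Rightarrow> (complex \<Rightarrow> complex) topology \<Rightarrow> bool" where
  "P2 \<Omega> X \<longleftrightarrow> (\<forall>w\<in>\<Omega>. continuous_map X euclidean (\<lambda>F. F w))"

definition P3 :: "(complex \<Rightarrow> complex) topology \<Rightarrow> bool" where
  "P3 X \<longleftrightarrow> continuous_map X X (\<lambda>F z. z * F z)"

definition shift_closure :: "(complex \<Rightarrow> complex) topology \<Rightarrow> (complex \<Rightarrow> complex) \<Rightarrow> (complex \<Rightarrow> complex) set" where
  "shift_closure X F = X closure_of range (\<lambda>P z. poly P z * F z)"

definition joint_shift_closure :: "(complex \<Rightarrow> complex) topology \<Rightarrow> (complex \<Rightarrow> complex) set \<Rightarrow> (complex \<Rightarrow> complex) set" where
  "joint_shift_closure X \<F> = X closure_of cfun.span (\<Union>F\<in>\<F>. shift_closure X F)"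

definition jointly_cyclic :: "(complex \<Rightarrow> complex) topology \<Rightarrow> (complex \<Rightarrow> complex) set \<Rightarrow> bool" where
  "jointly_cyclic X \<F> \<longleftrightarrow> joint_shift_closure X \<F> = topspace X"

definition common_zeros :: "complex poly set \<Rightarrow> complex set" where
  "common_zeros \<F> = {w. \<forall>P\<in>\<F>. poly P w = 0}"

definition continuous_linear_functional ::
    "(complex \<Rightarrow> complex) topology \<Rightarrow> ((complex \<Rightarrow> complex) \<Rightarrow> complex) \<Rightarrow> bool" where
  "continuous_linear_functional X L \<longleftrightarrow>
     (\<forall>f\<in>topspace X. \<forall>g\<in>topspace X. L (f + g) = L f + L g) \<and>
     (\<forall>c. \<forall>f\<in>topspace X. L (cfun_scale c f) = c * L f) \<and>
     continuous_map X euclidean L"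

definition maximal_domain :: "complex set \<Rightarrow> (complex \<Rightarrow> complex) topology \<Rightarrow> complex set" where
  "maximal_domain \<Omega> X =
     {w. \<exists>L. continuous_linear_functional X L \<and> (\<forall>P. L (poly_on \<Omega> P) = poly P w)}"

end

theory Submission
  imports Defs "HOL-Computational_Algebra.Fundamental_Theorem_Algebra"
begin

text \<open>If \<open>1\<close> is not in the closure \<open>M\<close> of \<open>{(z - w) Q}\<close>, then evaluation at \<open>w\<close> is bounded by some
  \<open>R\<close> on the polynomials in a neighbourhood \<open>U\<close> of \<open>0\<close>. The sets \<open>M + {|c| \<le> R} 1\<close> are closed, being
  projections along a compact factor, so \<open>U\<close> is contained in one of them; hence \<open>X = M + \<complex> 1\<close>
  and the coefficient of \<open>1\<close> is a continuous functional extending evaluation at \<open>w\<close>. No local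
  convexity is needed. Consequently multiples of \<open>z - w\<close> are dense whenever \<open>w\<close> is outside the
  maximal domain, and dividing out one root at a time shows that the multiples of the generator of
  the ideal spanned by \<open>\<F>\<close> are dense.\<close>

section \<open>Restrictions of polynomials and polynomial ideals\<close>

lemma poly_on_add: "poly_on \<Omega> (p + q) = poly_on \<Omega> p + poly_on \<Omega> q"
  by (auto simp: poly_on_def fun_eq_iff)

lemma poly_on_smult: "poly_on \<Omega> (smult c p) = cfun_scale c (poly_on \<Omega> p)"
  by (auto simp: poly_on_def cfun_scale_def fun_eq_iff)

lemma poly_on_mult: "poly_on \<Omega> (p * q) = (\<lambda>z. poly p z * poly_on \<Omega> q z)"
  by (auto simp: poly_on_def fun_eq_iff)

lemma poly_on_0: "poly_on \<Omega> 0 = 0"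
  by (auto simp: poly_on_def fun_eq_iff)

lemma cfun_diff_eq: "f - g = f + cfun_scale (-1) g"
  by (simp add: cfun_scale_def fun_eq_iff)

text \<open>Regards a polynomial ring as a module over itself, so that \<open>subspace\<close> means
  ideal and \<open>span\<close> means generated ideal.\<close>

lemma module_poly_mult: "module ((*) :: 'a::comm_ring_1 poly \<Rightarrow> _)"
  by unfold_locales (auto simp: algebra_simps)

text \<open>A nonzero element \<open>G\<close> of least degree works: the remainder of
  \<open>P\<close> modulo \<open>G\<close> stays in the ideal and would otherwise be nonzero of
  smaller degree.\<close>

lemma poly_ideal_generator:
  fixes J :: "'a::field poly set"
  assumes "module.subspace (*) J" "\<not> J \<subseteq> {0}"
  obtains G where "G \<in> J" "G \<noteq> 0" "\<And>P. P \<in> J \<Longrightarrow> G dvd P"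
proof -
  interpret module "(*) :: 'a poly \<Rightarrow> _" by (rule module_poly_mult)
  obtain P0 where "P0 \<in> J \<and> P0 \<noteq> 0" using assms(2) by auto
  then obtain G where G: "G \<in> J \<and> G \<noteq> 0" "\<And>P. P \<in> J \<and> P \<noteq> 0 \<Longrightarrow> degree G \<le> degree P"
    using ex_has_least_nat[of "\<lambda>P. P \<in> J \<and> P \<noteq> 0" P0 degree] by blast
  have "G dvd P" if "P \<in> J" for P
  proof -
    have "P mod G = P - (P div G) * G" by (simp add: minus_div_mult_eq_mod)
    moreover have "\<dots> \<in> J" using assms(1) that G(1) by (intro subspace_diff subspace_scale) auto
    ultimately have "P mod G \<in> J" by simp
    then have "P mod G = 0"
      using G degree_mod_less[of G P] by (metis leD)
    then show ?thesis by (simp add: dvd_eq_mod_eq_0)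
  qed
  then show thesis using that G by blast
qed

section \<open>Topological vector spaces of functions\<close>

locale function_tvs =
  fixes X :: "(complex \<Rightarrow> complex) topology"
  assumes tvs: "topological_vector_space X"
begin

lemma subspace_topspace: "cfun.subspace (topspace X)"
  using tvs by (simp add: topological_vector_space_def)

lemma topspace_add: "f \<in> topspace X \<Longrightarrow> g \<in> topspace X \<Longrightarrow> f + g \<in> topspace X"
  and topspace_scale: "f \<in> topspace X \<Longrightarrow> cfun_scale c f \<in> topspace X"
  and topspace_diff: "f \<in> topspace X \<Longrightarrow> g \<in> topspace X \<Longrightarrow> f - g \<in> topspace X"
  and topspace_0: "0 \<in> topspace X"
  using subspace_topspace
  by (auto intro: cfun.subspace_add cfun.subspace_scale cfun.subspace_diff cfun.subspace_0)

lemma continuous_map_cfun_add: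
  assumes "continuous_map Y X a" "continuous_map Y X b"
  shows "continuous_map Y X (\<lambda>y. a y + b y)"
proof -
  have "continuous_map (prod_topology X X) X (\<lambda>(f, g). f + g)"
    using tvs by (simp add: topological_vector_space_def)
  from continuous_map_compose[OF _ this, of Y "\<lambda>y. (a y, b y)"] show ?thesis
    using assms by (simp add: o_def continuous_map_paired)
qed

lemma continuous_map_cfun_scale:
  assumes "continuous_map Y euclidean a" "continuous_map Y X b"
  shows "continuous_map Y X (\<lambda>y. cfun_scale (a y) (b y))"
proof -
  have "continuous_map (prod_topology euclidean X) X (\<lambda>(c, f). cfun_scale c f)"
    using tvs by (simp add: topological_vector_space_def)
  from continuous_map_compose[OF _ this, of Y "\<lambda>y. (a y, b y)"] show ?thesis
    using assms by (simp add: o_def continuous_map_paired)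
qed

lemma continuous_map_cfun_diff:
  assumes "continuous_map Y X a" "continuous_map Y X b"
  shows "continuous_map Y X (\<lambda>y. a y - b y)"
  unfolding cfun_diff_eq using assms
  by (intro continuous_map_cfun_add continuous_map_cfun_scale) auto

text \<open>A continuous map sends the closure of a set into the closure of its image. For addition
  this is applied to \<open>S \<times> S\<close>, whose closure is the product of the
  closures.\<close>

lemma subspace_closure_of:
  assumes S: "cfun.subspace S" "S \<subseteq> topspace X"
  shows "cfun.subspace (X closure_of S)"
proof (rule cfun.subspaceI)
  show "0 \<in> X closure_of S"
    using closure_of_subset[OF S(2)] cfun.subspace_0[OF S(1)] by auto
  fix f g assume "f \<in> X closure_of S" "g \<in> X closure_of S"
  then have "(f, g) \<in> prod_topology X X closure_of (S \<times> S)"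
    by (simp add: closure_of_Times)
  moreover have "continuous_map (prod_topology X X) X (\<lambda>(f, g). f + g)"
    using tvs by (simp add: topological_vector_space_def)
  ultimately have "f + g \<in> X closure_of ((\<lambda>(f, g). f + g) ` (S \<times> S))"
    using continuous_map_image_closure_subset by fastforce
  moreover have "(\<lambda>(f, g). f + g) ` (S \<times> S) \<subseteq> S"
    using S(1) by (auto intro: cfun.subspace_add)
  ultimately show "f + g \<in> X closure_of S" using closure_of_mono by blast
next
  fix c f assume f: "f \<in> X closure_of S"
  have "continuous_map X X (\<lambda>f. cfun_scale c f)"
    by (intro continuous_map_cfun_scale) auto
  then have "cfun_scale c f \<in> X closure_of (cfun_scale c ` S)"
    using continuous_map_image_closure_subset f by fastforce
  moreover have "cfun_scale c ` S \<subseteq> S"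
    using S(1) by (auto intro: cfun.subspace_scale)
  ultimately show "cfun_scale c f \<in> X closure_of S" using closure_of_mono by blast
qed

text \<open>Neighbourhoods of \<open>0\<close> are absorbing, because
  \<open>c \<mapsto> cfun_scale c f\<close> is continuous and takes \<open>0\<close> to
  \<open>0\<close>.\<close>

lemma scaled_into_neighbourhood:
  assumes "openin X U" "0 \<in> U" "f \<in> topspace X"
  obtains c where "c \<noteq> 0" "cfun_scale c f \<in> U"
proof -
  have "continuous_map euclidean X (\<lambda>c. cfun_scale c f)"
    using assms by (intro continuous_map_cfun_scale) auto
  then have "open {c. cfun_scale c f \<in> U}"
    using assms(1) openin_continuous_map_preimage by fastforce
  moreover have "0 \<in> {c. cfun_scale c f \<in> U}"
    using assms by simp
  ultimately obtain e where e: "e > 0" "ball 0 e \<subseteq> {c. cfun_scale c f \<in> U}"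
    by (meson openE)
  then have "of_real (e / 2) \<in> {c. cfun_scale c f \<in> U}" by (intro subsetD[OF e(2)]) simp
  then show thesis using that[of "of_real (e / 2)"] e by auto
qed

lemma continuous_linear_functional_if_bounded:
  assumes add: "\<And>f g. f \<in> topspace X \<Longrightarrow> g \<in> topspace X \<Longrightarrow> L (f + g) = L f + L g"
    and scale: "\<And>c f. f \<in> topspace X \<Longrightarrow> L (cfun_scale c f) = c * L f"
    and U: "openin X U" "0 \<in> U" and bound: "\<And>f. f \<in> U \<Longrightarrow> cmod (L f) \<le> R"
  shows "continuous_linear_functional X L"
proof -
  have R: "R \<ge> 0" using bound[OF U(2)] norm_ge_zero order_trans by blast
  have "\<exists>T. openin X T \<and> f \<in> T \<and> (\<forall>g\<in>T - {f}. dist (L g) (L f) < e)"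
    if f: "f \<in> topspace X" and "e > 0" for f e
  proof -
    \<comment> \<open>The neighbourhood \<open>T\<close> of \<open>f\<close> is a translate of
      \<open>U\<close> shrunk by the factor \<open>e / (R + 1)\<close>, on which \<open>L\<close>
      varies by at most \<open>R * e / (R + 1) < e\<close>. The summand 1 makes this strict and
      avoids a zero factor when \<open>R = 0\<close>.\<close>
    define s where "s = complex_of_real ((R + 1) / e)"
    define T where "T = {g \<in> topspace X. cfun_scale s (g - f) \<in> U}"
    have "continuous_map X X (\<lambda>g. cfun_scale s (g - f))"
      using f by (intro continuous_map_cfun_scale continuous_map_cfun_diff) auto
    then have "openin X T"
      unfolding T_def using U(1) by (rule openin_continuous_map_preimage)
    moreover have "f \<in> T" using f U by (simp add: T_def)
    moreover have "dist (L g) (L f) < e" if "g \<in> T" for g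
    proof -
      have g: "g \<in> topspace X" "cfun_scale s (g - f) \<in> U" using that by (auto simp: T_def)
      have "L (g + cfun_scale (-1) f) = L g + (-1) * L f"
        using f g by (simp only: add scale topspace_scale)
      then have "L (g - f) = L g - L f" by simp
      then have "L (cfun_scale s (g - f)) = s * (L g - L f)"
        using f g by (simp add: scale topspace_diff)
      then have "cmod s * cmod (L g - L f) \<le> R" using bound[OF g(2)] by (simp add: norm_mult)
      moreover have "cmod s = (R + 1) / e" using R \<open>e > 0\<close> by (simp add: s_def del: of_real_divide)
      ultimately have "(R + 1) * cmod (L g - L f) \<le> R * e" using \<open>e > 0\<close> by (simp add: field_simps)
      also have "\<dots> < (R + 1) * e" using \<open>e > 0\<close> by simp
      finally have "cmod (L g - L f) < e" using R by simp
      then show ?thesis by (simp add: dist_norm)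
    qed
    ultimately show ?thesis by blast
  qed
  then have "continuous_map X euclidean L"
    unfolding continuous_map_atin limitin_canonical_iff tendsto_iff eventually_atin
    by blast
  then show ?thesis using add scale by (simp add: continuous_linear_functional_def)
qed

text \<open>Used to trap closed spans: a closed subspace containing the generators contains their
  closed linear span.\<close>

lemma closed_kernel:
  assumes L: "continuous_linear_functional X L"
  shows "closedin X {f \<in> topspace X. L f = 0}" "cfun.subspace {f \<in> topspace X. L f = 0}"
proof -
  have "continuous_map X euclidean L" using L by (simp add: continuous_linear_functional_def)
  then show "closedin X {f \<in> topspace X. L f = 0}"
    using closedin_continuous_map_preimage[of X euclidean L "{0}"] by simp
  have "L 0 = 0"
    using L topspace_0 unfolding continuous_linear_functional_def
    by (metis cfun.scale_zero_left mult_zero_left)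
  then show "cfun.subspace {f \<in> topspace X. L f = 0}"
    using L by (auto intro!: cfun.subspaceI
        simp: topspace_0 topspace_add topspace_scale continuous_linear_functional_def)
qed

text \<open>The pairs \<open>(c, f)\<close> with \<open>c\<close> in the disc and
  \<open>f - cfun_scale c e\<close> in \<open>M\<close> form a closed set; its projection to
  \<open>X\<close> is closed because the disc is compact.\<close>

lemma closedin_plus_bounded_multiples:
  assumes M: "closedin X M" and e: "e \<in> topspace X"
  shows "closedin X {f \<in> topspace X. \<exists>c. cmod c \<le> R \<and> f - cfun_scale c e \<in> M}"
proof -
  let ?K = "subtopology euclidean (cball (0::complex) R)"
  let ?h = "\<lambda>y. snd y - cfun_scale (fst y) e"
  have "continuous_map (prod_topology ?K X) X ?h"
    using e
    by (intro continuous_map_cfun_diff continuous_map_cfun_scale continuous_map_snd)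
       (auto intro: continuous_map_into_fulltopology continuous_map_fst)
  then have "closedin (prod_topology ?K X) {y \<in> topspace (prod_topology ?K X). ?h y \<in> M}"
    using M by (rule closedin_continuous_map_preimage)
  moreover have "closed_map (prod_topology ?K X) X snd"
    by (intro closed_map_snd) (simp add: compact_space_subtopology)
  ultimately have "closedin X (snd ` {y \<in> topspace (prod_topology ?K X). ?h y \<in> M})"
    by (simp add: closed_map_def)
  moreover have "snd ` {y \<in> topspace (prod_topology ?K X). ?h y \<in> M}
      = {f \<in> topspace X. \<exists>c. cmod c \<le> R \<and> f - cfun_scale c e \<in> M}"
    by (force simp: image_iff)
  ultimately show ?thesis by simp
qed

end

section \<open>Spaces with dense polynomials and continuous shift\<close>

locale polynomial_function_tvs = function_tvs X for X +
  fixes \<Omega> :: "complex set"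
  assumes P1: "P1 \<Omega> X" and P3: "P3 X"
begin

lemma poly_on_in_topspace: "poly_on \<Omega> p \<in> topspace X"
  using P1 by (auto simp: P1_def)

text \<open>Horner's scheme: multiplication by \<open>pCons a p\<close> is a scaling by
  \<open>a\<close> plus the shift composed with multiplication by \<open>p\<close>.\<close>

lemma continuous_map_poly_mult: "continuous_map X X (\<lambda>F z. poly p z * F z)"
proof (induction p)
  case 0
  have "(\<lambda>F z. poly 0 z * F z) = (\<lambda>F. 0 :: complex \<Rightarrow> complex)" by (auto simp: fun_eq_iff)
  then show ?case using topspace_0 by simp
next
  case (pCons a p)
  have "continuous_map X X ((\<lambda>F z. z * F z) \<circ> (\<lambda>F z. poly p z * F z))"
    using pCons P3 by (intro continuous_map_compose) (auto simp: P3_def)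
  then have "continuous_map X X (\<lambda>F. cfun_scale a F + (\<lambda>z. z * (poly p z * F z)))"
    by (intro continuous_map_cfun_add continuous_map_cfun_scale) (auto simp: o_def)
  moreover have "(\<lambda>F z. poly (pCons a p) z * F z)
      = (\<lambda>F. cfun_scale a F + (\<lambda>z. z * (poly p z * F z)))"
    by (auto simp: fun_eq_iff cfun_scale_def algebra_simps)
  ultimately show ?case by simp
qed

text \<open>The principal ideal generated by \<open>G\<close>, restricted to
  \<open>\<Omega>\<close>; its closure is the shift-invariant subspace generated by
  \<open>G\<close>.\<close>

definition multiples :: "complex poly \<Rightarrow> (complex \<Rightarrow> complex) set" where
  "multiples G = range (\<lambda>Q. poly_on \<Omega> (Q * G))"

lemma multiples_subset: "multiples G \<subseteq> topspace X"
  by (auto simp: multiples_def poly_on_in_topspace)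

lemma subspace_multiples: "cfun.subspace (multiples G)"
proof (rule cfun.subspaceI)
  show "0 \<in> multiples G"
    unfolding multiples_def by (rule range_eqI[of _ _ 0]) (simp add: poly_on_0)
  show "f + g \<in> multiples G" if "f \<in> multiples G" "g \<in> multiples G" for f g
    using that unfolding multiples_def
    by (auto simp flip: poly_on_add distrib_right)
  show "cfun_scale c f \<in> multiples G" if "f \<in> multiples G" for c f
    using that unfolding multiples_def
    by (auto simp flip: poly_on_smult mult_smult_left)
qed

text \<open>Modulo \<open>M\<close> every polynomial is congruent to its value at \<open>w\<close>
  times \<open>e\<close>, so \<open>e \<in> M\<close> puts all polynomials into \<open>M\<close>. If
  \<open>e \<notin> M\<close>, the coefficient of \<open>e\<close> modulo \<open>M\<close> is a
  continuous extension of evaluation at \<open>w\<close>, contrary to the choice of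
  \<open>w\<close>.\<close>

lemma multiples_linear_dense:
  assumes w: "w \<notin> maximal_domain \<Omega> X"
  shows "X closure_of multiples [:-w, 1:] = topspace X"
proof -
  define M where "M = X closure_of multiples [:-w, 1:]"
  define e where "e = poly_on \<Omega> 1"
  have e: "e \<in> topspace X" by (simp add: e_def poly_on_in_topspace)
  have M: "closedin X M" by (simp add: M_def)
  have sub: "cfun.subspace M"
    unfolding M_def by (intro subspace_closure_of subspace_multiples multiples_subset)
  have MX: "M \<subseteq> topspace X" using M closedin_subset by blast
  have poly_M: "poly_on \<Omega> p - cfun_scale (poly p w) e \<in> M" for p
  proof -
    obtain Q where "p - [:poly p w:] = [:-w, 1:] * Q"
      using poly_eq_0_iff_dvd[of "p - [:poly p w:]" w] by (auto elim: dvdE)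
    then have "p = Q * [:-w, 1:] + smult (poly p w) 1"
      by (simp add: algebra_simps)
    then have "poly_on \<Omega> p = poly_on \<Omega> (Q * [:-w, 1:]) + cfun_scale (poly p w) e"
      by (metis poly_on_add poly_on_smult e_def)
    then have "poly_on \<Omega> p - cfun_scale (poly p w) e \<in> multiples [:-w, 1:]"
      by (simp add: multiples_def)
    then show ?thesis
      using closure_of_subset[OF multiples_subset] by (auto simp: M_def)
  qed
  have "e \<in> M"
  proof (rule ccontr)
    assume eM: "e \<notin> M"
    \<comment> \<open>The two elements of \<open>M\<close> differ by \<open>(d - c) e\<close>, so
      \<open>c \<noteq> d\<close> would put \<open>e\<close> into \<open>M\<close>.\<close>
    have unique: "c = d" if "f - cfun_scale c e \<in> M" "f - cfun_scale d e \<in> M" for f c d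
    proof (rule ccontr)
      assume "c \<noteq> d"
      have "(f - cfun_scale c e) - (f - cfun_scale d e) \<in> M"
        using cfun.subspace_diff[OF sub that] .
      then have "cfun_scale (1 / (d - c)) ((f - cfun_scale c e) - (f - cfun_scale d e)) \<in> M"
        by (rule cfun.subspace_scale[OF sub])
      moreover have "cfun_scale (1 / (d - c)) ((f - cfun_scale c e) - (f - cfun_scale d e)) = e"
        using \<open>c \<noteq> d\<close> by (simp add: cfun_scale_def fun_eq_iff field_simps)
      ultimately show False using eM by simp
    qed
    \<comment> \<open>\<open>W\<close> is open and contains \<open>(0, 0)\<close> because
      \<open>e \<notin> M\<close>. A product neighbourhood inside it gives a radius \<open>d\<close>
      and a neighbourhood \<open>U\<close> with \<open>e - c f \<notin> M\<close> for all
      \<open>f \<in> U\<close> and \<open>cmod c < d\<close>.\<close>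
    define W where "W = {y \<in> topspace (prod_topology euclidean X).
      e - cfun_scale (fst y) (snd y) \<in> topspace X - M}"
    have "openin (prod_topology euclidean X) W"
      unfolding W_def using e M
      by (intro openin_continuous_map_preimage[of _ X] continuous_map_cfun_diff
          continuous_map_cfun_scale continuous_map_fst continuous_map_snd) auto
    moreover have "(0, 0) \<in> W" using e eM topspace_0 by (simp add: W_def)
    ultimately obtain A U where AU: "open A" "0 \<in> A" "openin X U" "0 \<in> U" "A \<times> U \<subseteq> W"
      unfolding openin_prod_topology_alt by (metis open_openin)
    then obtain d where d: "d > 0" "ball 0 d \<subseteq> A" by (meson openE)
    define R where "R = 1 / d"
    \<comment> \<open>A value \<open>a\<close> at \<open>w\<close> of modulus above
      \<open>1 / d\<close> would make \<open>c = 1 / a\<close> admissible, yet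
      \<open>e - p / a\<close> is a multiple of \<open>p - a e\<close>, which lies in
      \<open>M\<close>.\<close>
    have poly_bound: "cmod (poly p w) \<le> R" if "poly_on \<Omega> p \<in> U" for p
    proof (rule ccontr)
      define a where "a = poly p w"
      assume "\<not> cmod (poly p w) \<le> R"
      then have a: "cmod a > 1 / d" by (simp add: R_def a_def)
      then have "a \<noteq> 0" using d by auto
      have "cmod (1 / a) < d" using a d \<open>a \<noteq> 0\<close> by (simp add: norm_divide field_simps)
      then have "(1 / a, poly_on \<Omega> p) \<in> W" using AU d that by (auto simp: subset_iff)
      then have "e - cfun_scale (1 / a) (poly_on \<Omega> p) \<notin> M" by (simp add: W_def)
      moreover have "e - cfun_scale (1 / a) (poly_on \<Omega> p)
          = cfun_scale (- 1 / a) (poly_on \<Omega> p - cfun_scale a e)"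
        using \<open>a \<noteq> 0\<close> by (simp add: cfun_scale_def fun_eq_iff field_simps)
      ultimately show False
        using cfun.subspace_scale[OF sub poly_M, of "- 1 / a" p] unfolding a_def by metis
    qed
    define B where "B = {f \<in> topspace X. \<exists>c. cmod c \<le> R \<and> f - cfun_scale c e \<in> M}"
    have "closedin X B" unfolding B_def by (intro closedin_plus_bounded_multiples M e)
    moreover have "U \<inter> range (poly_on \<Omega>) \<subseteq> B"
      using poly_bound poly_M by (auto simp: B_def poly_on_in_topspace)
    ultimately have "X closure_of (U \<inter> range (poly_on \<Omega>)) \<subseteq> B"
      by (simp add: closure_of_minimal)
    \<comment> \<open>Since \<open>U\<close> is open and polynomials are dense in \<open>X\<close>,
      the polynomials lying in \<open>U\<close> are dense in \<open>U\<close>.\<close>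
    moreover have "U \<subseteq> X closure_of (U \<inter> range (poly_on \<Omega>))"
    proof -
      have "U \<inter> X closure_of range (poly_on \<Omega>) \<subseteq> X closure_of (U \<inter> range (poly_on \<Omega>))"
        using AU(3) by (rule openin_Int_closure_of_subset)
      moreover have "U \<subseteq> topspace X" using AU(3) openin_subset by blast
      ultimately show ?thesis using P1 by (auto simp: P1_def)
    qed
    ultimately have UB: "U \<subseteq> B" by blast
    \<comment> \<open>At most one such \<open>c\<close> exists by \<open>unique\<close>. Existence
      for every \<open>f\<close> in the space follows from \<open>U \<subseteq> B\<close>, as
      \<open>U\<close> is absorbing.\<close>
    define L where "L f = (THE c. f - cfun_scale c e \<in> M)" for f
    have L_eq: "L f = c" if "f - cfun_scale c e \<in> M" for f c
      unfolding L_def using that unique by blast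
    have L_mem: "f - cfun_scale (L f) e \<in> M" if f: "f \<in> topspace X" for f
    proof -
      obtain a where a: "a \<noteq> 0" "cfun_scale a f \<in> U"
        using scaled_into_neighbourhood AU f by blast
      then obtain c where "cfun_scale a f - cfun_scale c e \<in> M" using UB by (auto simp: B_def)
      then have "cfun_scale (1 / a) (cfun_scale a f - cfun_scale c e) \<in> M"
        by (rule cfun.subspace_scale[OF sub])
      moreover have "cfun_scale (1 / a) (cfun_scale a f - cfun_scale c e)
          = f - cfun_scale (c / a) e"
        using a by (simp add: cfun_scale_def fun_eq_iff field_simps)
      ultimately show ?thesis using L_eq by metis
    qed
    have "continuous_linear_functional X L"
    proof (rule continuous_linear_functional_if_bounded)
      fix f g assume fg: "f \<in> topspace X" "g \<in> topspace X"
      have "(f - cfun_scale (L f) e) + (g - cfun_scale (L g) e) \<in> M"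
        using fg by (intro cfun.subspace_add[OF sub] L_mem)
      moreover have "(f - cfun_scale (L f) e) + (g - cfun_scale (L g) e)
          = f + g - cfun_scale (L f + L g) e"
        by (simp add: cfun_scale_def fun_eq_iff algebra_simps)
      ultimately show "L (f + g) = L f + L g" using L_eq by simp
    next
      fix c f assume f: "f \<in> topspace X"
      have "cfun_scale c (f - cfun_scale (L f) e) \<in> M"
        using f by (intro cfun.subspace_scale[OF sub] L_mem)
      moreover have "cfun_scale c (f - cfun_scale (L f) e) = cfun_scale c f - cfun_scale (c * L f) e"
        by (simp add: cfun_scale_def fun_eq_iff algebra_simps)
      ultimately show "L (cfun_scale c f) = c * L f" using L_eq by simp
    next
      show "openin X U" "0 \<in> U" by fact+
      show "cmod (L f) \<le> R" if "f \<in> U" for f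
        using that UB L_eq by (auto simp: B_def)
    qed
    moreover have "L (poly_on \<Omega> p) = poly p w" for p using L_eq poly_M by blast
    ultimately show False using w by (auto simp: maximal_domain_def)
  qed
  then have "poly_on \<Omega> p \<in> M" for p
    using cfun.subspace_add[OF sub poly_M[of p] cfun.subspace_scale[OF sub, of e "poly p w"]] by simp
  then have "X closure_of range (poly_on \<Omega>) \<subseteq> M" using M by (intro closure_of_minimal) auto
  then show ?thesis using P1 MX by (auto simp: P1_def M_def)
qed

text \<open>Write \<open>G = (z - w) H\<close>. Multiplication by \<open>H\<close> is continuous and
  carries the dense multiples of \<open>z - w\<close> onto the multiples of \<open>G\<close>. Hence
  the closure of the latter contains \<open>H\<close> times the whole space, in particular the
  multiples of \<open>H\<close>, which are dense by induction on the degree.\<close>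

lemma multiples_dense:
  assumes "G \<noteq> 0" "\<And>w. poly G w = 0 \<Longrightarrow> w \<notin> maximal_domain \<Omega> X"
  shows "X closure_of multiples G = topspace X"
  using assms
proof (induction "degree G" arbitrary: G)
  case 0
  then obtain a where G: "G = [:a:]" by (auto elim: degree_eq_zeroE)
  with 0 have "a \<noteq> 0" by auto
  have "poly_on \<Omega> p \<in> multiples G" for p
    unfolding multiples_def G using \<open>a \<noteq> 0\<close> by (intro range_eqI[of _ _ "smult (1 / a) p"]) simp
  then have "multiples G = range (poly_on \<Omega>)" by (auto simp: multiples_def)
  then show ?case using P1 by (simp add: P1_def)
next
  case (Suc n)
  obtain w where w: "poly G w = 0"
    using alg_closed_imp_poly_has_root[of G] Suc.hyps(2) by auto
  then obtain H where GH: "G = [:-w, 1:] * H" by (auto simp: poly_eq_0_iff_dvd elim: dvdE)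
  with Suc.prems have "H \<noteq> 0" by auto
  moreover have "n = degree H"
    using GH Suc.hyps(2) \<open>H \<noteq> 0\<close> by (simp add: degree_mult_eq del: mult_pCons_left)
  ultimately have IH: "X closure_of multiples H = topspace X"
    using Suc.prems(2) by (intro Suc.hyps(1)) (simp_all add: GH)
  have "(\<lambda>F z. poly H z * F z) ` (X closure_of multiples [:-w, 1:])
      \<subseteq> X closure_of ((\<lambda>F z. poly H z * F z) ` multiples [:-w, 1:])"
    by (intro continuous_map_image_closure_subset continuous_map_poly_mult)
  moreover have "(\<lambda>F z. poly H z * F z) ` multiples [:-w, 1:] = multiples G"
    unfolding multiples_def GH image_image poly_on_mult[symmetric] by (simp only: mult_ac)
  ultimately have "(\<lambda>F z. poly H z * F z) ` topspace X \<subseteq> X closure_of multiples G"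
    using multiples_linear_dense Suc.prems(2)[OF w] by simp
  moreover have "multiples H \<subseteq> (\<lambda>F z. poly H z * F z) ` topspace X"
    by (auto simp: multiples_def mult.commute[of _ H] poly_on_mult[of _ H]
        intro!: imageI poly_on_in_topspace)
  ultimately have "multiples H \<subseteq> X closure_of multiples G" by blast
  then have "X closure_of multiples H \<subseteq> X closure_of multiples G"
    by (simp add: closure_of_minimal)
  then show ?case using IH closure_of_subset_topspace[of X "multiples G"] by simp
qed

section \<open>Joint cyclicity of families of polynomials\<close>

lemma shift_closure_poly_on: "shift_closure X (poly_on \<Omega> p) = X closure_of multiples p"
  by (simp add: shift_closure_def multiples_def poly_on_mult)

text \<open>The obstruction to cyclicity: \<open>L\<close> vanishes on all multiples of members of
  \<open>\<F>\<close>, and its kernel is a closed subspace.\<close>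

lemma joint_shift_closure_subset_kernel:
  assumes L: "continuous_linear_functional X L" "\<And>P. L (poly_on \<Omega> P) = poly P w"
    and w: "w \<in> common_zeros \<F>"
  shows "joint_shift_closure X (poly_on \<Omega> ` \<F>) \<subseteq> {f \<in> topspace X. L f = 0}"
proof -
  have "X closure_of multiples P \<subseteq> {f \<in> topspace X. L f = 0}" if "P \<in> \<F>" for P
    using that w L(2)
    by (intro closure_of_minimal closed_kernel[OF L(1)])
       (auto simp: multiples_def common_zeros_def poly_on_in_topspace)
  then show ?thesis
    unfolding joint_shift_closure_def
    by (intro closure_of_minimal cfun.span_minimal closed_kernel[OF L(1)])
       (auto simp: shift_closure_poly_on)
qed

text \<open>The zeros of a generator \<open>G\<close> of the ideal spanned by \<open>\<F>\<close>
  are common zeros of \<open>\<F>\<close>, so none lies in the maximal domain and the multiples of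
  \<open>G\<close> are dense.\<close>

lemma jointly_cyclic_if_no_common_zeros:
  assumes disj: "common_zeros \<F> \<inter> maximal_domain \<Omega> X = {}" and ne: "maximal_domain \<Omega> X \<noteq> {}"
  shows "jointly_cyclic X (poly_on \<Omega> ` \<F>)"
proof -
  interpret poly: module "(*) :: complex poly \<Rightarrow> _" by (rule module_poly_mult)
  define S where "S = (\<Union>F\<in>poly_on \<Omega> ` \<F>. shift_closure X F)"
  \<comment> \<open>For the zero ideal every point is a common zero, which a nonempty maximal domain
    rules out.\<close>
  have "\<not> poly.span \<F> \<subseteq> {0}"
  proof
    assume "poly.span \<F> \<subseteq> {0}"
    then have "\<F> \<subseteq> {0}" using poly.span_superset by blast
    then have "common_zeros \<F> = UNIV" by (auto simp: common_zeros_def)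
    then show False using disj ne by simp
  qed
  then obtain G where G: "G \<in> poly.span \<F>" "G \<noteq> 0" "\<And>P. P \<in> poly.span \<F> \<Longrightarrow> G dvd P"
    using poly_ideal_generator[OF poly.subspace_span] by blast
  have "w \<notin> maximal_domain \<Omega> X" if "poly G w = 0" for w
  proof -
    have "poly P w = 0" if "P \<in> \<F>" for P
      using G(3)[OF poly.span_base[OF that]] \<open>poly G w = 0\<close> by (auto elim!: dvdE)
    then show ?thesis using disj by (auto simp: common_zeros_def)
  qed
  then have dense: "X closure_of multiples G = topspace X" using G(2) by (intro multiples_dense)
  \<comment> \<open>The ideal allows polynomial coefficients, the linear span only scalars. The gap
    closes because each product \<open>c * P\<close> already lies in the shift closure of
    \<open>P\<close>.\<close>
  have span: "poly_on \<Omega> p \<in> cfun.span S" if "p \<in> poly.span \<F>" for p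
    using that
  proof (induction rule: poly.span_induct_alt)
    case base
    show ?case unfolding poly_on_0 by (rule cfun.span_zero)
  next
    case (step c P q)
    have "poly_on \<Omega> (c * P) \<in> multiples P" by (simp add: multiples_def)
    then have "poly_on \<Omega> (c * P) \<in> S"
      using closure_of_subset[OF multiples_subset] step(1)
      by (auto simp: S_def shift_closure_poly_on)
    then show ?case
      using step unfolding poly_on_add by (blast intro: cfun.span_add cfun.span_base)
  qed
  have "multiples G \<subseteq> cfun.span S"
    unfolding multiples_def using G(1) by (auto intro: span poly.span_scale)
  then have "topspace X \<subseteq> X closure_of cfun.span S"
    using dense closure_of_mono by blast
  then show ?thesis
    unfolding jointly_cyclic_def joint_shift_closure_def S_def
    by (intro subset_antisym closure_of_subset_topspace)
qed

end

text \<open>Evaluation at a point of \<open>\<Omega>\<close> is itself the required extension. For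
  nonempty \<open>\<Omega>\<close> this makes the maximal domain nonempty.\<close>

lemma subset_maximal_domain:
  assumes "P2 \<Omega> X" shows "\<Omega> \<subseteq> maximal_domain \<Omega> X"
proof
  fix w assume "w \<in> \<Omega>"
  then have "continuous_linear_functional X (\<lambda>F. F w)"
    using assms by (simp add: continuous_linear_functional_def P2_def cfun_scale_def)
  then show "w \<in> maximal_domain \<Omega> X"
    using \<open>w \<in> \<Omega>\<close> by (auto simp: maximal_domain_def poly_on_def intro!: exI[of _ "\<lambda>F. F w"])
qed

theorem corollary3p6:
  fixes \<Omega> :: "complex set"
    and X :: "(complex \<Rightarrow> complex) topology"
    and \<F> :: "complex poly set"
  assumes "open \<Omega>" and "\<Omega> \<noteq> {}"
    and "topspace X \<subseteq> Hol \<Omega>"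
    and "topological_vector_space X" and "Hausdorff_space X"
    and "P1 \<Omega> X" and "P2 \<Omega> X" and "P3 X"
  shows "jointly_cyclic X (poly_on \<Omega> ` \<F>) \<longleftrightarrow> common_zeros \<F> \<inter> maximal_domain \<Omega> X = {}"
proof -
  interpret polynomial_function_tvs X \<Omega>
    using assms by unfold_locales
  show ?thesis
  proof
    assume cyclic: "jointly_cyclic X (poly_on \<Omega> ` \<F>)"
    have False if "w \<in> common_zeros \<F>" "w \<in> maximal_domain \<Omega> X" for w
    proof -
      obtain L where L: "continuous_linear_functional X L" "\<And>P. L (poly_on \<Omega> P) = poly P w"
        using \<open>w \<in> maximal_domain \<Omega> X\<close> by (auto simp: maximal_domain_def)
      then have "topspace X \<subseteq> {f \<in> topspace X. L f = 0}"
        using joint_shift_closure_subset_kernel that(1) cyclic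
        by (metis jointly_cyclic_def)
      \<comment> \<open>\<open>L\<close> extends evaluation at \<open>w\<close>, so it takes the
        constant polynomial 1 to 1 and cannot vanish on the whole space.\<close>
      then have "L (poly_on \<Omega> 1) = 0" using poly_on_in_topspace by blast
      then show False by (simp add: L(2))
    qed
    then show "common_zeros \<F> \<inter> maximal_domain \<Omega> X = {}" by blast
  next
    assume "common_zeros \<F> \<inter> maximal_domain \<Omega> X = {}"
    then show "jointly_cyclic X (poly_on \<Omega> ` \<F>)"
      using subset_maximal_domain[OF assms(7)] assms(2) by (intro jointly_cyclic_if_no_common_zeros) auto
  qed
qed

end
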